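(* Let $Z(x,t)$ be a CSBP with Laplace exponent $\varphi(q,t)$ and branching mechanism $\Psi$. Let $b,c>0$. Then the rescaled CSBP given by $$\tilde Z(x,t)=b^{-1}Z(bx,ct)$$ satisfies $\tilde Z(x,0)=x$ and has Laplace exponent $\tilde\varphi$ and branching mechanism $\tilde\Psi$ with $$\tilde\varphi(q,t)=b\,\varphi(b^{-1}q,ct),\qquad\tilde\Psi(q)=cb\,\Psi(b^{-1}q).$$ If the branching mechanism $\Psi$ is (sub)critical and given in terms of a Lévy triple $(\alpha_0,\alpha_\infty,\mu)$ by $$\Psi(q)=\tfrac12\alpha_0q^2+\alpha_\infty q+\int_{(0,\infty)}\frac{e^{-qx}-1+qx}{x}\,d\mu(x),$$ then $\tilde\Psi$ is given by the same formula with the Lévy triple $(\tilde\alpha_0,\tilde\alpha_\infty,\tilde\mu)$, where $$\tilde\alpha_0=cb^{-1}\alpha_0,\qquad\tilde\alpha_\infty=c\,\alpha_\infty,\qquad d\tilde\mu(x)=c\,d\mu(bx),$$ and this corresponds to left and right distribution functions given by the scaling relations $$\tilde\kappa_L(x)=cb^{-1}\kappa_L(bx),\qquad\tilde\kappa_R(x)=c\,\kappa_R(bx).$$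
   Context: A CSBP (continuous-state branching process) is a two-parameter random process $Z(x,t)=Z_t(x)$, $x>0$, $t\ge 0$, such that for fixed $x$, $t\mapsto Z(x,t)$ is a Markov process with $Z(x,0)=x$, and for fixed $t$, $x\mapsto Z(x,t)$ is increasing with independent stationary increments. Its Laplace exponent $\varphi$ is defined by $\mathbb{E}(e^{-qZ(x,t)})=e^{-x\varphi(q,t)}$, and its branching mechanism $\Psi$ is the function for which $\partial_t\varphi(q,t)=-\Psi(\varphi(q,t))$, $\varphi(q,0)=q$. In general $\Psi(q)=\frac12a_0q^2-aq-b_0+\int_{(0,\infty)}(e^{-qx}-1+qx\mathbf{1}_{\{x<1\}})\,d\pi(x)$ with $a_0,b_0\ge0$, $a\in\mathbb{R}$, $\int(1\wedge x^2)\,d\pi<\infty$. A Lévy triple is $(\alpha_0,\alpha_\infty,\mu)$ with $\alpha_0,\alpha_\infty\ge 0$ and $\mu$ a nonnegative measure on $(0,\infty)$ with $\int_{(0,\infty)}(x\wedge 1)\,d\mu(x)<\infty$. The notation $d\tilde\mu(x)=c\,d\mu(bx)$ means $\tilde\mu(A)=c\,\mu(bA)$ for Borel $A\subset(0,\infty)$. The left and right distribution functions of a Lévy triple are $$\kappa_L(x)=\alpha_0+\int_{(0,x]}z\,d\mu(z),\qquad\kappa_R(x)=\alpha_\infty+\int_{(x,\infty)}d\mu,$$ and $\tilde\kappa_L,\tilde\kappa_R$ are those of $(\tilde\alpha_0,\tilde\alpha_\infty,\tilde\mu)$. *)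

theory Defs
  imports "HOL-Probability.Probability"
begin

section \<open>Continuous-state branching processes\<close>

text \<open>
  Processes take values in \<open>[0,\<infinity>]\<close>, since a branching mechanism with \<open>b\<^sub>0 > 0\<close>
  (and some with \<open>b\<^sub>0 = 0\<close>) belongs to a process that reaches \<open>\<infinity>\<close>.
\<close>

definition generated_by :: "'w measure \<Rightarrow> (real \<Rightarrow> 'w \<Rightarrow> ennreal) \<Rightarrow> real set \<Rightarrow> 'w measure" where
  "generated_by M X I =
     sigma (space M) (\<Union>i\<in>I. {X i -` B \<inter> space M | B. B \<in> sets borel})"

definition markov_process :: "'w measure \<Rightarrow> (real \<Rightarrow> 'w \<Rightarrow> ennreal) \<Rightarrow> bool" where
  "markov_process M X \<longleftrightarrow>
     (\<forall>t\<ge>0. X t \<in> borel_measurable M) \<and>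
     (\<forall>s t. \<forall>B\<in>sets borel. 0 \<le> s \<and> s \<le> t \<longrightarrow>
        (AE \<omega> in M.
           real_cond_exp M (generated_by M X {0..s}) (indicator (X t -` B \<inter> space M)) \<omega> =
           real_cond_exp M (generated_by M X {s}) (indicator (X t -` B \<inter> space M)) \<omega>))"

text \<open>
  The value \<open>\<infinity>\<close> is a cemetery, so, as for (killed) subordinators, increments are considered
  while the process is finite: conditionally on \<open>Y y < \<infinity>\<close>, the increment \<open>Y (y + h) - Y y\<close> is
  independent of \<open>(Y x)\<close>, \<open>0 < x \<le> y\<close>, and is distributed as \<open>Y h\<close>, the increment over
  \<open>(0,h]\<close> of a process starting from \<open>0\<close>. (The formula has been multiplied by the
  probability of the conditioning event; if \<open>Y\<close> is finite, this is ordinary independence and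
  stationarity.)
\<close>

definition indep_stationary_increments :: "'w measure \<Rightarrow> (real \<Rightarrow> 'w \<Rightarrow> ennreal) \<Rightarrow> bool" where
  "indep_stationary_increments M Y \<longleftrightarrow>
     (\<forall>x>0. Y x \<in> borel_measurable M) \<and>
     (\<forall>y>0. \<forall>h>0. \<forall>A\<in>sets (generated_by M Y {0<..y}). \<forall>B\<in>sets borel.
        measure M {\<omega> \<in> space M. \<omega> \<in> A \<and> Y y \<omega> < \<infinity> \<and> Y (y + h) \<omega> - Y y \<omega> \<in> B} =
        measure M {\<omega> \<in> space M. \<omega> \<in> A \<and> Y y \<omega> < \<infinity>} *
        measure M {\<omega> \<in> space M. Y h \<omega> \<in> B})"

definition csbp :: "'w measure \<Rightarrow> (real \<Rightarrow> real \<Rightarrow> 'w \<Rightarrow> ennreal) \<Rightarrow> bool" where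
  "csbp M Z \<longleftrightarrow>
     prob_space M \<and>
     (\<forall>x>0. markov_process M (\<lambda>t. Z x t) \<and> (\<forall>\<omega>\<in>space M. Z x 0 \<omega> = ennreal x)) \<and>
     (\<forall>t\<ge>0. indep_stationary_increments M (\<lambda>x. Z x t) \<and>
        (\<forall>\<omega>\<in>space M. \<forall>x y. 0 < x \<and> x \<le> y \<longrightarrow> Z x t \<omega> \<le> Z y t \<omega>))"

text \<open>\<open>e\<^sup>-\<^sup>q\<^sup>z\<close> for \<open>q > 0\<close> and \<open>z \<in> [0,\<infinity>]\<close>.\<close>

definition exp_neg :: "real \<Rightarrow> ennreal \<Rightarrow> real" where
  "exp_neg q z = (if z = \<infinity> then 0 else exp (- q * enn2real z))"

definition has_laplace_exponent ::
    "'w measure \<Rightarrow> (real \<Rightarrow> real \<Rightarrow> 'w \<Rightarrow> ennreal) \<Rightarrow> (real \<Rightarrow> real \<Rightarrow> real) \<Rightarrow> bool" where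
  "has_laplace_exponent M Z \<phi> \<longleftrightarrow>
     (\<forall>x>0. \<forall>q>0. \<forall>t\<ge>0. prob_space.expectation M (\<lambda>\<omega>. exp_neg q (Z x t \<omega>)) = exp (- x * \<phi> q t))"

definition has_branching_mechanism :: "(real \<Rightarrow> real \<Rightarrow> real) \<Rightarrow> (real \<Rightarrow> real) \<Rightarrow> bool" where
  "has_branching_mechanism \<phi> \<Psi> \<longleftrightarrow>
     (\<forall>q>0. \<phi> q 0 = q \<and>
        (\<forall>t\<ge>0. ((\<lambda>t. \<phi> q t) has_real_derivative - \<Psi> (\<phi> q t)) (at t within {0..})))"

text \<open>Both notions determine their functions on the relevant domains.\<close>

lemma has_laplace_exponent_unique:
  assumes "has_laplace_exponent M Z \<phi>" "has_laplace_exponent M Z \<phi>'" "0 < q" "0 \<le> t"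
  shows "\<phi> q t = \<phi>' q t"
proof -
  have "exp (- 1 * \<phi> q t) = exp (- 1 * \<phi>' q t)"
    using assms unfolding has_laplace_exponent_def by (metis zero_less_one)
  then show ?thesis by simp
qed

lemma has_branching_mechanism_unique:
  assumes "has_branching_mechanism \<phi> \<Psi>" "has_branching_mechanism \<phi> \<Psi>'" "0 < q"
  shows "\<Psi> q = \<Psi>' q"
proof -
  have nontriv: "at (0::real) within {0..} \<noteq> bot"
    by (simp add: at_within_Ici_at_right)
  have "((\<lambda>t. \<phi> q t) has_real_derivative - \<Psi> q) (at 0 within {0..})"
       "((\<lambda>t. \<phi> q t) has_real_derivative - \<Psi>' q) (at 0 within {0..})"
    using assms unfolding has_branching_mechanism_def by (metis order_refl)+
  then have "- \<Psi> q = - \<Psi>' q"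
    using nontriv unfolding has_field_derivative_iff by (metis tendsto_unique)
  then show ?thesis by simp
qed

text \<open>(Sub)critical means \<open>\<Psi>'(0+) \<ge> 0\<close>.\<close>

definition critical_or_subcritical :: "(real \<Rightarrow> real) \<Rightarrow> bool" where
  "critical_or_subcritical \<Psi> \<longleftrightarrow>
     (\<exists>\<Psi>' L. (\<forall>q>0. (\<Psi> has_real_derivative \<Psi>' q) (at q)) \<and> (\<Psi>' \<longlongrightarrow> L) (at_right 0) \<and> 0 \<le> L)"

definition rescale_csbp ::
    "real \<Rightarrow> real \<Rightarrow> (real \<Rightarrow> real \<Rightarrow> 'w \<Rightarrow> ennreal) \<Rightarrow> (real \<Rightarrow> real \<Rightarrow> 'w \<Rightarrow> ennreal)" where
  "rescale_csbp b c Z = (\<lambda>x t \<omega>. ennreal (inverse b) * Z (b * x) (c * t) \<omega>)"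


section \<open>Levy triples\<close>

definition levy_triple :: "real \<Rightarrow> real \<Rightarrow> real measure \<Rightarrow> bool" where
  "levy_triple \<alpha>0 \<alpha>inf \<mu> \<longleftrightarrow>
     0 \<le> \<alpha>0 \<and> 0 \<le> \<alpha>inf \<and>
     sets \<mu> = sets (restrict_space borel {0<..}) \<and>
     (\<integral>\<^sup>+ x. ennreal (min x 1) \<partial>\<mu>) < \<infinity>"

definition kappaL :: "real \<Rightarrow> real measure \<Rightarrow> real \<Rightarrow> real" where
  "kappaL \<alpha>0 \<mu> x = \<alpha>0 + (LINT z:{0<..x}|\<mu>. z)"

definition kappaR :: "real \<Rightarrow> real measure \<Rightarrow> real \<Rightarrow> real" where
  "kappaR \<alpha>inf \<mu> x = \<alpha>inf + measure \<mu> {x<..}"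

definition levy_mechanism :: "real \<Rightarrow> real \<Rightarrow> real measure \<Rightarrow> real \<Rightarrow> real" where
  "levy_mechanism \<alpha>0 \<alpha>inf \<mu> q =
     1 / 2 * \<alpha>0 * q\<^sup>2 + \<alpha>inf * q + (LINT x|\<mu>. (exp (- q * x) - 1 + q * x) / x)"

text \<open>The measure \<open>c d\<mu>(bx)\<close>; its defining property is proved as \<open>emeasure_rescale_measure\<close>.\<close>

definition rescale_measure :: "real \<Rightarrow> real \<Rightarrow> real measure \<Rightarrow> real measure" where
  "rescale_measure b c \<mu> = scale_measure (ennreal c) (distr \<mu> \<mu> (\<lambda>x. x / b))"

lemma emeasure_rescale_measure:
  assumes "levy_triple \<alpha>0 \<alpha>inf \<mu>" "0 < b" "A \<in> sets (restrict_space borel {0<..})"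
  shows "emeasure (rescale_measure b c \<mu>) A = ennreal c * emeasure \<mu> ((\<lambda>x. b * x) ` A)"
proof -
  have s: "sets \<mu> = sets (restrict_space borel {0<..})"
    using assms(1) by (simp add: levy_triple_def)
  have sp: "space \<mu> = {0<..}"
    using sets_eq_imp_space_eq[OF s] by (simp add: space_restrict_space)
  have "(\<lambda>x. x / b) \<in> restrict_space borel {0<..} \<rightarrow>\<^sub>M restrict_space borel {0::real<..}"
    using \<open>0 < b\<close> by (intro measurable_restrict_space3) auto
  then have m: "(\<lambda>x. x / b) \<in> \<mu> \<rightarrow>\<^sub>M \<mu>"
    using s by (simp cong: measurable_cong_sets)
  have A: "A \<in> sets \<mu>" using assms(3) s by simp
  have "(\<lambda>x. x / b) -` A \<inter> space \<mu> = (\<lambda>x. b * x) ` A"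
    using \<open>0 < b\<close> sets.sets_into_space[OF A] sp by (force simp: image_iff)
  then show ?thesis
    using m A by (simp add: rescale_measure_def emeasure_distr)
qed

end

theory Submission
  imports Defs
begin

text \<open>
  The rescaled process arises from \<open>Z\<close> by two bijective changes of variable and a multiplication
  by the constant \<open>b\<inverse>\<close>, and each part of the conclusion is invariant under these.

  For the probabilistic part, multiplication by a constant \<open>k \<in> (0,\<infinity>)\<close> is a Borel automorphism of
  \<open>[0,\<infinity>]\<close>. Hence \<open>k X\<close> and \<open>X\<close> generate the same events, and a linear change of the index only
  relabels the index set (lemma \<open>generated_by_rescale\<close>). The Markov property and the independence of
  increments speak about a process only through such events, so both pass to the rescaled process
  (\<open>markov_process_rescale\<close>, \<open>indep_stationary_increments_rescale\<close>). The factor \<open>k\<close> inside an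
  exponential \<open>e\<^sup>-\<^sup>q\<^sup>z\<close> is absorbed into \<open>q\<close>, which gives the Laplace exponent, and the chain
  rule gives the branching mechanism.

  For the analytic part, the tool is the change of variables
  \<open>\<integral> f d\<mu>' = c \<integral> f(x/b) d\<mu>(x)\<close> for the measure \<open>\<mu>'\<close> given by \<open>d\<mu>'(x) = c d\<mu>(bx)\<close>
  (\<open>integral_rescale_measure\<close>). The substitution \<open>x \<mapsto> x/b\<close> turns \<open>(e\<^sup>-\<^sup>q\<^sup>x - 1 + qx)/x\<close> into \<open>b\<close> times
  the same integrand with \<open>q/b\<close> in place of \<open>q\<close>, and it turns the integral over \<open>(0,x]\<close> in the left
  distribution function into one over \<open>(0,bx]\<close>. For the right distribution function it is enough to
  compare the measures of the half lines \<open>(x,\<infinity>)\<close> and \<open>(bx,\<infinity>)\<close>.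
\<close>

section \<open>Events generated by a rescaled process\<close>

lemma vimage_cmult_borel_ennreal:
  fixes k :: ennreal
  assumes "B \<in> sets borel"
  shows "(\<lambda>z. k * z) -` B \<in> sets borel"
proof -
  have "(\<lambda>z::ennreal. k * z) \<in> borel_measurable borel" by measurable
  from measurable_sets[OF this assms] show ?thesis by simp
qed

lemma inverse_mult_cancel_ennreal:
  fixes k z :: ennreal
  assumes "0 < k" "k < \<infinity>"
  shows "inverse k * (k * z) = z"
proof -
  have "k * inverse k = 1"
    using assms by (intro ennreal_divide_self[unfolded divide_ennreal_def]) auto
  then have "inverse k * k = 1" by (simp add: mult.commute)
  then show ?thesis by (simp add: mult.assoc[symmetric])
qed

lemma events_of_cmult:
  fixes k :: ennreal
  assumes k: "0 < k" "k < \<infinity>"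
  shows "{(\<lambda>\<omega>. k * Y \<omega>) -` B \<inter> S | B. B \<in> sets borel} = {Y -` B \<inter> S | B. B \<in> sets borel}"
    (is "?L = ?R")
proof (intro subset_antisym subsetI)
  fix A assume "A \<in> ?L"
  then obtain B where B: "B \<in> sets borel" "A = (\<lambda>\<omega>. k * Y \<omega>) -` B \<inter> S" by blast
  then have "A = Y -` ((\<lambda>z. k * z) -` B) \<inter> S" by auto
  then show "A \<in> ?R" using vimage_cmult_borel_ennreal[OF B(1)] by blast
next
  fix A assume "A \<in> ?R"
  then obtain B where B: "B \<in> sets borel" "A = Y -` B \<inter> S" by blast
  then have "A = (\<lambda>\<omega>. k * Y \<omega>) -` ((\<lambda>z. inverse k * z) -` B) \<inter> S"
    using inverse_mult_cancel_ennreal[OF k] by auto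
  then show "A \<in> ?L" using vimage_cmult_borel_ennreal[OF B(1)] by blast
qed

text \<open>
  A generated \<open>\<sigma>\<close>-algebra depends only on the set of random variables that generate it, so a change
  of index moves to the index set. It is used for time \<open>t \<mapsto> c t\<close> and for the initial value \<open>x \<mapsto> b x\<close>.
\<close>

lemma generated_by_rescale:
  fixes k :: ennreal
  assumes "0 < k" "k < \<infinity>"
  shows "generated_by M (\<lambda>i \<omega>. k * X (r i) \<omega>) I = generated_by M X (r ` I)"
  unfolding generated_by_def events_of_cmult[OF assms] by simp

lemma image_cmult_Icc_0:
  fixes c s :: real
  assumes "0 < c" "0 \<le> s"
  shows "(\<lambda>t. c * t) ` {0..s} = {0..c * s}"
  using assms by simp

lemma image_cmult_Ioc_0:
  fixes b y :: real
  assumes "0 < b"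
  shows "(\<lambda>x. b * x) ` {0<..y} = {0<..b * y}"
proof (intro subset_antisym subsetI)
  fix x assume "x \<in> {0<..b * y}"
  then have "x / b \<in> {0<..y}" "x = b * (x / b)"
    using assms by (auto simp: field_simps)
  then show "x \<in> (\<lambda>x. b * x) ` {0<..y}" by blast
qed (use assms in auto)


section \<open>Rescaled processes\<close>

lemma markov_process_rescale:
  fixes k :: ennreal
  assumes X: "markov_process M X" and k: "0 < k" "k < \<infinity>" and c: "0 < c"
  shows "markov_process M (\<lambda>t \<omega>. k * X (c * t) \<omega>)"
  unfolding markov_process_def
proof (intro conjI allI ballI impI)
  fix t :: real assume "0 \<le> t"
  then have "X (c * t) \<in> borel_measurable M"
    using X c by (simp add: markov_process_def)
  then show "(\<lambda>\<omega>. k * X (c * t) \<omega>) \<in> borel_measurable M" by measurable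
next
  fix s t :: real and B :: "ennreal set"
  assume B: "B \<in> sets borel" and st: "0 \<le> s \<and> s \<le> t"
  have past: "generated_by M (\<lambda>t \<omega>. k * X (c * t) \<omega>) {0..s} = generated_by M X {0..c * s}"
    using generated_by_rescale[OF k, of M X "\<lambda>t. c * t"] image_cmult_Icc_0[OF c] st by simp
  have present: "generated_by M (\<lambda>t \<omega>. k * X (c * t) \<omega>) {s} = generated_by M X {c * s}"
    using generated_by_rescale[OF k, of M X "\<lambda>t. c * t"] by simp
  have future: "(\<lambda>\<omega>. k * X (c * t) \<omega>) -` B = X (c * t) -` ((\<lambda>z. k * z) -` B)"
    by auto
  have "0 \<le> c * s \<and> c * s \<le> c * t" using st c by simp
  then show "AE \<omega> in M.
      real_cond_exp M (generated_by M (\<lambda>t \<omega>. k * X (c * t) \<omega>) {0..s})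
        (indicator ((\<lambda>\<omega>. k * X (c * t) \<omega>) -` B \<inter> space M)) \<omega> =
      real_cond_exp M (generated_by M (\<lambda>t \<omega>. k * X (c * t) \<omega>) {s})
        (indicator ((\<lambda>\<omega>. k * X (c * t) \<omega>) -` B \<inter> space M)) \<omega>"
    unfolding past present future
    using X vimage_cmult_borel_ennreal[OF B, of k] unfolding markov_process_def by blast
qed

lemma indep_stationary_increments_rescale:
  fixes k :: ennreal
  assumes Y: "indep_stationary_increments M Y" and k: "0 < k" "k < \<infinity>" and b: "0 < b"
  shows "indep_stationary_increments M (\<lambda>x \<omega>. k * Y (b * x) \<omega>)"
  unfolding indep_stationary_increments_def
proof (intro conjI allI ballI impI)
  fix x :: real assume "0 < x"
  then have "Y (b * x) \<in> borel_measurable M"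
    using Y b by (simp add: indep_stationary_increments_def)
  then show "(\<lambda>\<omega>. k * Y (b * x) \<omega>) \<in> borel_measurable M" by measurable
next
  fix y h :: real and A and B :: "ennreal set"
  assume y: "0 < y" and h: "0 < h" and B: "B \<in> sets borel"
    and "A \<in> sets (generated_by M (\<lambda>x \<omega>. k * Y (b * x) \<omega>) {0<..y})"
  then have A: "A \<in> sets (generated_by M Y {0<..b * y})"
    using generated_by_rescale[OF k, of M Y "\<lambda>x. b * x"] image_cmult_Ioc_0[OF b] by simp
  have finite: "k * z < \<infinity> \<longleftrightarrow> z < \<infinity>" for z
    using k by (auto simp: ennreal_mult_less_top ennreal_mult_eq_top_iff less_top[symmetric])
  have increment: "k * Y (b * (y + h)) \<omega> - k * Y (b * y) \<omega> \<in> B \<longleftrightarrow>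
      Y (b * y + b * h) \<omega> - Y (b * y) \<omega> \<in> (\<lambda>z. k * z) -` B" for \<omega>
    using k by (simp add: ennreal_right_diff_distrib less_top distrib_left)
  have "0 < b * y" "0 < b * h" using y h b by simp_all
  then have "measure M {\<omega> \<in> space M. \<omega> \<in> A \<and> Y (b * y) \<omega> < \<infinity> \<and>
        Y (b * y + b * h) \<omega> - Y (b * y) \<omega> \<in> (\<lambda>z. k * z) -` B} =
      measure M {\<omega> \<in> space M. \<omega> \<in> A \<and> Y (b * y) \<omega> < \<infinity>} *
      measure M {\<omega> \<in> space M. Y (b * h) \<omega> \<in> (\<lambda>z. k * z) -` B}"
    using Y A vimage_cmult_borel_ennreal[OF B, of k]
    unfolding indep_stationary_increments_def by blast
  then show "measure M {\<omega> \<in> space M. \<omega> \<in> A \<and> k * Y (b * y) \<omega> < \<infinity> \<and>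
        k * Y (b * (y + h)) \<omega> - k * Y (b * y) \<omega> \<in> B} =
      measure M {\<omega> \<in> space M. \<omega> \<in> A \<and> k * Y (b * y) \<omega> < \<infinity>} *
      measure M {\<omega> \<in> space M. k * Y (b * h) \<omega> \<in> B}"
    unfolding finite increment by simp
qed

lemma rescale_csbp_at_0:
  assumes "csbp M Z" "0 < b" "0 < x" "\<omega> \<in> space M"
  shows "rescale_csbp b c Z x 0 \<omega> = ennreal x"
proof -
  have "Z (b * x) 0 \<omega> = ennreal (b * x)"
    using assms unfolding csbp_def by simp
  then show ?thesis
    using assms by (simp add: rescale_csbp_def ennreal_mult[symmetric] mult.assoc[symmetric])
qed

lemma csbp_rescale_csbp:
  assumes Z: "csbp M Z" and b: "0 < b" and c: "0 < c"
  shows "csbp M (rescale_csbp b c Z)"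
  unfolding csbp_def
proof (intro conjI allI impI ballI)
  show "prob_space M" using Z by (simp add: csbp_def)
next
  fix x :: real assume "0 < x"
  then have "markov_process M (\<lambda>t. Z (b * x) t)"
    using Z b by (simp add: csbp_def)
  then show "markov_process M (\<lambda>t. rescale_csbp b c Z x t)"
    unfolding rescale_csbp_def using b c by (intro markov_process_rescale) auto
next
  fix x :: real and \<omega> assume "0 < x" "\<omega> \<in> space M"
  then show "rescale_csbp b c Z x 0 \<omega> = ennreal x"
    using rescale_csbp_at_0[OF Z b] by simp
next
  fix t :: real assume "0 \<le> t"
  then have "indep_stationary_increments M (\<lambda>x. Z x (c * t))"
    using Z c by (simp add: csbp_def)
  then show "indep_stationary_increments M (\<lambda>x. rescale_csbp b c Z x t)"
    unfolding rescale_csbp_def using b by (intro indep_stationary_increments_rescale) auto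
next
  fix t x y :: real and \<omega>
  assume "0 \<le> t" "\<omega> \<in> space M" "0 < x \<and> x \<le> y"
  then have "Z (b * x) (c * t) \<omega> \<le> Z (b * y) (c * t) \<omega>"
    using Z b c by (simp add: csbp_def)
  then show "rescale_csbp b c Z x t \<omega> \<le> rescale_csbp b c Z y t \<omega>"
    by (simp add: rescale_csbp_def mult_left_mono)
qed

lemma exp_neg_cmult:
  assumes "0 < k"
  shows "exp_neg q (ennreal k * z) = exp_neg (k * q) z"
  using assms by (auto simp: exp_neg_def ennreal_mult_eq_top_iff enn2real_mult mult_ac)

lemma has_laplace_exponent_rescale_csbp:
  assumes "has_laplace_exponent M Z \<phi>" "0 < b" "0 < c"
  shows "has_laplace_exponent M (rescale_csbp b c Z) (\<lambda>q t. b * \<phi> (inverse b * q) (c * t))"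
  using assms by (simp add: has_laplace_exponent_def rescale_csbp_def exp_neg_cmult mult_ac)

lemma has_branching_mechanism_rescale:
  assumes \<phi>: "has_branching_mechanism \<phi> \<Psi>" and b: "0 < b" and c: "0 < c"
  shows "has_branching_mechanism (\<lambda>q t. b * \<phi> (inverse b * q) (c * t))
           (\<lambda>q. c * b * \<Psi> (inverse b * q))"
  unfolding has_branching_mechanism_def
proof (intro allI impI conjI)
  fix q :: real assume q: "0 < q"
  show "b * \<phi> (inverse b * q) (c * 0) = q"
    using \<phi> b q by (simp add: has_branching_mechanism_def)
next
  fix q t :: real assume q: "0 < q" and t: "0 \<le> t"
  let ?p = "\<phi> (inverse b * q)"
  \<comment> \<open>The derivatives are one-sided at time \<open>0\<close>; the chain rule applies because \<open>t \<mapsto> c t\<close> maps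
    the half line into itself.\<close>
  have "(?p has_real_derivative - \<Psi> (?p (c * t))) (at (c * t) within {0..})"
    using \<phi> b c q t by (simp add: has_branching_mechanism_def)
  then have "(?p has_real_derivative - \<Psi> (?p (c * t))) (at (c * t) within (\<lambda>t. c * t) ` {0..})"
    by (rule DERIV_subset) (use c in auto)
  moreover have "((\<lambda>t. c * t) has_real_derivative c) (at t within {0..})"
    by (auto intro!: derivative_eq_intros)
  ultimately have "(?p \<circ> (\<lambda>t. c * t) has_real_derivative - \<Psi> (?p (c * t)) * c) (at t within {0..})"
    by (rule DERIV_image_chain)
  then have "((\<lambda>t. ?p (c * t)) has_real_derivative - \<Psi> (?p (c * t)) * c) (at t within {0..})"
    by (simp only: o_def)
  note deriv = DERIV_cmult[OF this, of b]
  have cancel: "inverse b * (b * ?p (c * t)) = ?p (c * t)"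
    using b by simp
  from deriv
  show "((\<lambda>t. b * ?p (c * t)) has_real_derivative
      - (c * b * \<Psi> (inverse b * (b * ?p (c * t))))) (at t within {0..})"
    unfolding cancel by (simp add: mult_ac)
qed


section \<open>Rescaled Levy triples\<close>

lemma measurable_divide_levy:
  fixes \<mu> :: "real measure"
  assumes s: "sets \<mu> = sets (restrict_space borel {0<..})" and b: "0 < b"
  shows "(\<lambda>x. x / b) \<in> \<mu> \<rightarrow>\<^sub>M \<mu>"
proof -
  have "(\<lambda>x. x / b) \<in> restrict_space borel {0<..} \<rightarrow>\<^sub>M restrict_space borel {0::real<..}"
    using b by (intro measurable_restrict_space3) auto
  then show ?thesis using s by (simp cong: measurable_cong_sets)
qed

lemma borel_measurable_levy:
  fixes \<mu> :: "real measure"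
  assumes s: "sets \<mu> = sets (restrict_space borel {0<..})" and f: "f \<in> borel_measurable borel"
  shows "f \<in> borel_measurable \<mu>"
  using measurable_restrict_space1[OF f, of "{0<..}"] s by (simp cong: measurable_cong_sets)

lemma scale_measure_eq_density: "scale_measure r M = density M (\<lambda>_. r)"
  by (rule measure_eqI) (auto simp: emeasure_density_const)

lemma nn_integral_rescale_measure:
  fixes f :: "real \<Rightarrow> ennreal"
  assumes s: "sets \<mu> = sets (restrict_space borel {0<..})" and b: "0 < b"
    and f: "f \<in> borel_measurable borel"
  shows "(\<integral>\<^sup>+ x. f x \<partial>rescale_measure b c \<mu>) = ennreal c * (\<integral>\<^sup>+ x. f (x / b) \<partial>\<mu>)"
  using measurable_divide_levy[OF s b] borel_measurable_levy[OF s f]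
  by (simp add: rescale_measure_def nn_integral_scale_measure nn_integral_distr)

lemma integral_rescale_measure:
  fixes f :: "real \<Rightarrow> real"
  assumes s: "sets \<mu> = sets (restrict_space borel {0<..})" and b: "0 < b" and c: "0 \<le> c"
    and f: "f \<in> borel_measurable borel"
  shows "(LINT x|rescale_measure b c \<mu>. f x) = c * (LINT x|\<mu>. f (x / b))"
  using measurable_divide_levy[OF s b] borel_measurable_levy[OF s f] c
  by (simp add: rescale_measure_def scale_measure_eq_density integral_density integral_distr)

text \<open>
  Integrability of \<open>x \<and> 1\<close> survives the change of variables because
  \<open>(x/b) \<and> 1 \<le> max(1/b, 1) (x \<and> 1)\<close>.
\<close>

lemma levy_triple_rescale:
  assumes L: "levy_triple \<alpha>0 \<alpha>inf \<mu>" and b: "0 < b" and c: "0 < c"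
  shows "levy_triple (c * inverse b * \<alpha>0) (c * \<alpha>inf) (rescale_measure b c \<mu>)"
proof -
  have s: "sets \<mu> = sets (restrict_space borel {0<..})"
    using L by (simp add: levy_triple_def)
  have sp: "space \<mu> = {0<..}"
    using sets_eq_imp_space_eq[OF s] by (simp add: space_restrict_space)
  define K where "K = max (1 / b) 1"
  have bound: "min (x / b) 1 \<le> K * min x 1" if "0 < x" for x
  proof (cases "x \<le> 1")
    case True
    have "1 / b * x \<le> K * x" using that by (intro mult_right_mono) (auto simp: K_def)
    then show ?thesis using True by simp
  next
    case False
    then show ?thesis by (simp add: K_def)
  qed
  have min_meas: "(\<lambda>x. ennreal (min x 1)) \<in> borel_measurable borel" by measurable
  have "(\<integral>\<^sup>+ x. ennreal (min (x / b) 1) \<partial>\<mu>) \<le> (\<integral>\<^sup>+ x. ennreal K * ennreal (min x 1) \<partial>\<mu>)"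
    using bound by (intro nn_integral_mono) (auto simp: sp K_def ennreal_mult[symmetric])
  also have "\<dots> = ennreal K * (\<integral>\<^sup>+ x. ennreal (min x 1) \<partial>\<mu>)"
    by (intro nn_integral_cmult borel_measurable_levy[OF s] min_meas)
  also have "\<dots> < \<infinity>"
    using L by (simp add: levy_triple_def ennreal_mult_less_top)
  finally have "(\<integral>\<^sup>+ x. ennreal (min x 1) \<partial>rescale_measure b c \<mu>) < \<infinity>"
    using nn_integral_rescale_measure[OF s b min_meas, of c] by (simp add: ennreal_mult_less_top)
  moreover have "sets (rescale_measure b c \<mu>) = sets (restrict_space borel {0<..})"
    using s by (simp add: rescale_measure_def)
  ultimately show ?thesis
    using L b c by (simp add: levy_triple_def)
qed

lemma levy_mechanism_rescale:
  assumes L: "levy_triple \<alpha>0 \<alpha>inf \<mu>" and b: "0 < b" and c: "0 < c"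
  shows "levy_mechanism (c * inverse b * \<alpha>0) (c * \<alpha>inf) (rescale_measure b c \<mu>) q =
           c * b * levy_mechanism \<alpha>0 \<alpha>inf \<mu> (inverse b * q)"
proof -
  have s: "sets \<mu> = sets (restrict_space borel {0<..})"
    using L by (simp add: levy_triple_def)
  have "(\<lambda>x. (exp (- q * x) - 1 + q * x) / x) \<in> borel_measurable borel" by measurable
  then have "(LINT x|rescale_measure b c \<mu>. (exp (- q * x) - 1 + q * x) / x) =
      c * (LINT x|\<mu>. (exp (- q * (x / b)) - 1 + q * (x / b)) / (x / b))"
    using b c by (intro integral_rescale_measure[OF s]) auto
  also have "(\<lambda>x. (exp (- q * (x / b)) - 1 + q * (x / b)) / (x / b)) =
      (\<lambda>x. b * ((exp (- (inverse b * q) * x) - 1 + inverse b * q * x) / x))"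
    by (simp add: field_simps)
  finally have "(LINT x|rescale_measure b c \<mu>. (exp (- q * x) - 1 + q * x) / x) =
      c * b * (LINT x|\<mu>. (exp (- (inverse b * q) * x) - 1 + inverse b * q * x) / x)"
    by (simp add: mult.assoc del: times_divide_eq_right)
  moreover have "1 / 2 * (c * inverse b * \<alpha>0) * q\<^sup>2 + c * \<alpha>inf * q =
      c * b * (1 / 2 * \<alpha>0 * (inverse b * q)\<^sup>2 + \<alpha>inf * (inverse b * q))"
    using b by (simp add: field_simps power2_eq_square)
  ultimately show ?thesis
    unfolding levy_mechanism_def by (simp only: distrib_left)
qed

lemma kappaL_rescale:
  assumes L: "levy_triple \<alpha>0 \<alpha>inf \<mu>" and b: "0 < b" and c: "0 < c"
  shows "kappaL (c * inverse b * \<alpha>0) (rescale_measure b c \<mu>) x = c * inverse b * kappaL \<alpha>0 \<mu> (b * x)"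
proof -
  have s: "sets \<mu> = sets (restrict_space borel {0<..})"
    using L by (simp add: levy_triple_def)
  have "(\<lambda>z. indicator {0<..x} z *\<^sub>R z) \<in> borel_measurable borel" by measurable
  then have "(LINT z:{0<..x}|rescale_measure b c \<mu>. z) =
      c * (LINT z|\<mu>. indicator {0<..x} (z / b) *\<^sub>R (z / b))"
    unfolding set_lebesgue_integral_def
    using b c by (intro integral_rescale_measure[OF s]) auto
  also have "(\<lambda>z. indicator {0<..x} (z / b) *\<^sub>R (z / b)) =
      (\<lambda>z. inverse b * (indicator {0<..b * x} z *\<^sub>R z))"
    using b by (auto simp: indicator_def field_simps)
  finally have "(LINT z:{0<..x}|rescale_measure b c \<mu>. z) =
      c * inverse b * (LINT z:{0<..b * x}|\<mu>. z)"
    by (simp add: set_lebesgue_integral_def mult.assoc)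
  then show ?thesis by (simp add: kappaL_def algebra_simps)
qed

lemma kappaR_rescale:
  assumes L: "levy_triple \<alpha>0 \<alpha>inf \<mu>" and b: "0 < b" and c: "0 < c" and x: "0 \<le> x"
  shows "kappaR (c * \<alpha>inf) (rescale_measure b c \<mu>) x = c * kappaR \<alpha>inf \<mu> (b * x)"
proof -
  have A: "{x<..} \<in> sets (restrict_space borel {0<..})"
    using x by (subst sets_restrict_space_iff) auto
  have "(\<lambda>z. b * z) ` {x<..} = {b * x<..}"
  proof (intro subset_antisym subsetI)
    fix z assume "z \<in> {b * x<..}"
    then have "z / b \<in> {x<..}" "z = b * (z / b)" using b by (auto simp: field_simps)
    then show "z \<in> (\<lambda>z. b * z) ` {x<..}" by blast
  qed (use b in auto)
  then have "measure (rescale_measure b c \<mu>) {x<..} = c * measure \<mu> {b * x<..}"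
    using emeasure_rescale_measure[OF L b A, of c] c by (simp add: measure_def enn2real_mult)
  then show ?thesis by (simp add: kappaR_def algebra_simps)
qed


section \<open>Scaling of continuous-state branching processes\<close>

theorem proposition9p1:
  fixes M :: "'w measure"
    and Z :: "real \<Rightarrow> real \<Rightarrow> 'w \<Rightarrow> ennreal"
    and \<phi> :: "real \<Rightarrow> real \<Rightarrow> real"
    and \<Psi> :: "real \<Rightarrow> real"
    and b c :: real
  assumes "csbp M Z"
    and "has_laplace_exponent M Z \<phi>"
    and "has_branching_mechanism \<phi> \<Psi>"
    and "0 < b" and "0 < c"
  shows "csbp M (rescale_csbp b c Z)
    \<and> (\<forall>x>0. \<forall>\<omega>\<in>space M. rescale_csbp b c Z x 0 \<omega> = ennreal x)
    \<and> has_laplace_exponent M (rescale_csbp b c Z) (\<lambda>q t. b * \<phi> (inverse b * q) (c * t))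
    \<and> has_branching_mechanism (\<lambda>q t. b * \<phi> (inverse b * q) (c * t))
        (\<lambda>q. c * b * \<Psi> (inverse b * q))
    \<and> (\<forall>\<alpha>0 \<alpha>inf \<mu>.
        critical_or_subcritical \<Psi> \<and> levy_triple \<alpha>0 \<alpha>inf \<mu> \<and>
        (\<forall>q>0. \<Psi> q = levy_mechanism \<alpha>0 \<alpha>inf \<mu> q) \<longrightarrow>
          levy_triple (c * inverse b * \<alpha>0) (c * \<alpha>inf) (rescale_measure b c \<mu>) \<and>
          (\<forall>q>0. c * b * \<Psi> (inverse b * q) =
             levy_mechanism (c * inverse b * \<alpha>0) (c * \<alpha>inf) (rescale_measure b c \<mu>) q) \<and>
          (\<forall>x>0. kappaL (c * inverse b * \<alpha>0) (rescale_measure b c \<mu>) x =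
             c * inverse b * kappaL \<alpha>0 \<mu> (b * x)) \<and>
          (\<forall>x>0. kappaR (c * \<alpha>inf) (rescale_measure b c \<mu>) x =
             c * kappaR \<alpha>inf \<mu> (b * x)))"
proof (intro conjI allI impI ballI)
  note Z = assms(1) and b = assms(4) and c = assms(5)
  show "csbp M (rescale_csbp b c Z)"
    by (rule csbp_rescale_csbp[OF Z b c])
  show "rescale_csbp b c Z x 0 \<omega> = ennreal x" if "0 < x" "\<omega> \<in> space M" for x \<omega>
    by (rule rescale_csbp_at_0[OF Z b that])
  show "has_laplace_exponent M (rescale_csbp b c Z) (\<lambda>q t. b * \<phi> (inverse b * q) (c * t))"
    by (rule has_laplace_exponent_rescale_csbp[OF assms(2) b c])
  show "has_branching_mechanism (\<lambda>q t. b * \<phi> (inverse b * q) (c * t))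
      (\<lambda>q. c * b * \<Psi> (inverse b * q))"
    by (rule has_branching_mechanism_rescale[OF assms(3) b c])
  fix \<alpha>0 \<alpha>inf \<mu>
  assume asm: "critical_or_subcritical \<Psi> \<and> levy_triple \<alpha>0 \<alpha>inf \<mu> \<and>
    (\<forall>q>0. \<Psi> q = levy_mechanism \<alpha>0 \<alpha>inf \<mu> q)"
  then have L: "levy_triple \<alpha>0 \<alpha>inf \<mu>" by blast
  show "levy_triple (c * inverse b * \<alpha>0) (c * \<alpha>inf) (rescale_measure b c \<mu>)"
    by (rule levy_triple_rescale[OF L b c])
  show "c * b * \<Psi> (inverse b * q) =
      levy_mechanism (c * inverse b * \<alpha>0) (c * \<alpha>inf) (rescale_measure b c \<mu>) q"
    if "0 < q" for q
    using asm that b by (simp add: levy_mechanism_rescale[OF L b c])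
  show "kappaL (c * inverse b * \<alpha>0) (rescale_measure b c \<mu>) x =
      c * inverse b * kappaL \<alpha>0 \<mu> (b * x)" if "0 < x" for x
    by (rule kappaL_rescale[OF L b c])
  show "kappaR (c * \<alpha>inf) (rescale_measure b c \<mu>) x = c * kappaR \<alpha>inf \<mu> (b * x)"
    if "0 < x" for x
    using that by (intro kappaR_rescale[OF L b c]) simp
qed

end
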